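(* Let $D$ be an integral domain with quotient field $K$ and $n\ge1$. Let $\mathcal C_n$ be the set of companion matrices of monic polynomials of degree $n$ in $D[x]$, and $\mathcal I_n\subseteq\mathcal C_n$ the subset of companion matrices of monic degree-$n$ polynomials that are irreducible in $D[x]$. Then (1) $\mathrm{Int}_K(M_n(D))=\mathrm{Int}_K(\mathcal C_n, M_n(D))$; (2) if moreover the intersection of all maximal ideals of $D$ of finite index is $(0)$ (for instance, if $D$ is a Dedekind domain with infinitely many maximal ideals of finite index), then $\mathrm{Int}_K(M_n(D))=\mathrm{Int}_K(\mathcal I_n, M_n(D))$.
   Context: $M_n(D)$ is the ring of $n\times n$ matrices over $D$. For a subset $S\subseteq M_n(D)$, $\mathrm{Int}_K(S,M_n(D))=\{f\in K[x]\mid f(C)\in M_n(D)\text{ for all }C\in S\}$, where $f(C)$ is computed in $M_n(K)$; and $\mathrm{Int}_K(M_n(D))=\mathrm{Int}_K(M_n(D),M_n(D))$. *)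

theory Defs
  imports "Jordan_Normal_Form.Matrix"
          "HOL-Computational_Algebra.Polynomial"
          "HOL-Computational_Algebra.Fraction_Field"
          "HOL-Computational_Algebra.Polynomial_Factorial"
begin

definition poly_mat_eval :: "'b::comm_ring_1 poly \<Rightarrow> 'b mat \<Rightarrow> 'b mat" where
  "poly_mat_eval f A =
     mat (dim_row A) (dim_col A)
       (\<lambda>(i,j). \<Sum>k\<le>degree f. coeff f k * (A ^\<^sub>m k) $$ (i,j))"

definition Mn_D_in_K :: "nat \<Rightarrow> ('a::idom) fract mat set" where
  "Mn_D_in_K n = map_mat to_fract ` (carrier_mat n n :: 'a mat set)"

definition IntK :: "nat \<Rightarrow> ('a::idom) mat set \<Rightarrow> 'a fract poly set" where
  "IntK n S = {f. \<forall>C\<in>S. poly_mat_eval f (map_mat to_fract C) \<in> Mn_D_in_K n}"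

definition companion_mat :: "nat \<Rightarrow> 'b::comm_ring_1 poly \<Rightarrow> 'b mat" where
  "companion_mat n p = mat n n
     (\<lambda>(i,j). if j = n - 1 then - coeff p i else if i = j + 1 then 1 else 0)"

definition companions :: "nat \<Rightarrow> ('a::idom) mat set" where
  "companions n = {companion_mat n p | p. lead_coeff p = 1 \<and> degree p = n}"

definition irred_companions :: "nat \<Rightarrow> ('a::idom) mat set" where
  "irred_companions n = {companion_mat n p | p. lead_coeff p = 1 \<and> degree p = n \<and> irreducible p}"

definition is_ideal :: "('a::comm_ring_1) set \<Rightarrow> bool" where
  "is_ideal I \<longleftrightarrow> 0 \<in> I \<and> (\<forall>x\<in>I. \<forall>y\<in>I. x + y \<in> I) \<and> (\<forall>r. \<forall>x\<in>I. r * x \<in> I)"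

definition is_maximal_ideal :: "('a::comm_ring_1) set \<Rightarrow> bool" where
  "is_maximal_ideal I \<longleftrightarrow> is_ideal I \<and> I \<noteq> UNIV \<and>
     (\<forall>J. is_ideal J \<and> I \<subseteq> J \<longrightarrow> J = I \<or> J = UNIV)"

definition finite_index :: "('a::comm_ring_1) set \<Rightarrow> bool" where
  "finite_index I \<longleftrightarrow> finite (UNIV // {(x, y). x - y \<in> I})"

end

theory Submission
  imports Defs "Jordan_Normal_Form.Char_Poly"
begin

text \<open>Write \<open>f = g / d\<close> with \<open>g \<in> D[x]\<close>, so that \<open>f\<close> is integer-valued at \<open>C\<close> iff \<open>d\<close> divides \<open>g(C)\<close>.
  Dividing \<open>g\<close> by a monic \<open>p\<close> of degree \<open>n\<close>, the remainder \<open>r\<close> satisfies \<open>g(C) = r(C)\<close> for the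
  companion matrix \<open>C\<close> of \<open>p\<close>, and the first column of \<open>r(C)\<close> lists the coefficients of \<open>r\<close>. So
  \<open>d\<close> divides \<open>g(C)\<close> iff \<open>g \<in> (p, d)\<close>, and by Cayley--Hamilton \<open>d\<close> then divides \<open>g(A)\<close> for every
  \<open>A\<close> with characteristic polynomial \<open>p\<close>. As \<open>(p, d)\<close> depends only on \<open>p\<close> modulo \<open>d\<close>, the second
  part needs a monic irreducible polynomial congruent to \<open>p\<close> modulo \<open>d\<close>. It is found by the Chinese
  remainder theorem: for each \<open>0 < i < n\<close> prescribe the polynomial modulo a fresh maximal ideal of
  finite index so as to exclude monic factors of degree \<open>i\<close>.\<close>

section \<open>Polynomials in a linear operator\<close>

text \<open>Vectors are functions on an index type, so the calculus of polynomials in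
  \<open>T\<close> involves no dimensions. It makes the vectors a module over the polynomial
  ring.\<close>

locale linear_operator =
  fixes T :: "('i \<Rightarrow> 'a::comm_ring_1) \<Rightarrow> 'i \<Rightarrow> 'a"
  assumes add: "T (\<lambda>i. x i + y i) = (\<lambda>i. T x i + T y i)"
    and scale: "T (\<lambda>i. c * x i) = (\<lambda>i. c * T x i)"
begin

definition act :: "'a poly \<Rightarrow> ('i \<Rightarrow> 'a) \<Rightarrow> 'i \<Rightarrow> 'a" where
  "act f x = (\<lambda>i. \<Sum>k\<le>degree f. coeff f k * (T ^^ k) x i)"

lemma act_eq:
  assumes "degree f \<le> N"
  shows "act f x i = (\<Sum>k\<le>N. coeff f k * (T ^^ k) x i)"
  unfolding act_def
  by (rule sum.mono_neutral_left) (use assms in \<open>auto simp: coeff_eq_0\<close>)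

lemma zero: "T (\<lambda>i. 0) = (\<lambda>i. 0)"
  using scale[of 0 "\<lambda>i. 0"] by simp

lemma sum: "T (\<lambda>i. \<Sum>k\<in>K. y k i) = (\<lambda>i. \<Sum>k\<in>K. T (y k) i)"
  by (induction K rule: infinite_finite_induct) (auto simp: zero add)

lemma act_0 [simp]: "act 0 x = (\<lambda>i. 0)"
  by (simp add: act_def)

text \<open>Horner's scheme; this recursion drives the inductions showing that \<open>act\<close> is
  a module action.\<close>

lemma act_pCons: "act (pCons a f) x = (\<lambda>i. a * x i + T (act f x) i)"
proof
  fix i
  have "act (pCons a f) x i
      = (\<Sum>k\<le>Suc (degree f). coeff (pCons a f) k * (T ^^ k) x i)"
    by (rule act_eq) (rule degree_pCons_le)
  also have "\<dots> = a * x i + (\<Sum>k\<le>degree f. coeff f k * T ((T ^^ k) x) i)"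
    by (subst sum.atMost_Suc_shift) simp
  also have "(\<Sum>k\<le>degree f. coeff f k * T ((T ^^ k) x) i) = T (act f x) i"
    unfolding act_def by (simp add: sum scale)
  finally show "act (pCons a f) x i = a * x i + T (act f x) i" .
qed

lemma act_add: "act (f + g) x = (\<lambda>i. act f x i + act g x i)"
proof
  fix i
  let ?N = "max (degree f) (degree g)"
  show "act (f + g) x i = act f x i + act g x i"
    by (simp add: act_eq[of _ ?N] degree_add_le sum.distrib distrib_right)
qed

lemma act_smult: "act (smult c f) x = (\<lambda>i. c * act f x i)"
proof
  fix i
  show "act (smult c f) x i = c * act f x i"
    by (simp add: act_eq[of _ "degree f"] degree_smult_le sum_distrib_left mult.assoc)
qed

lemma act_mult: "act (f * g) x = act f (act g x)"
  by (induction f) (auto simp: act_add act_smult act_pCons)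

lemma act_poly_sum: "act (\<Sum>k\<in>K. f k) x = (\<lambda>i. \<Sum>k\<in>K. act (f k) x i)"
  by (induction K rule: infinite_finite_induct) (auto simp: act_add)

lemma act_zero_vec: "act f (\<lambda>i. 0) = (\<lambda>i. 0)"
  by (induction f) (auto simp: act_pCons zero)

lemma act_add_vec: "act f (\<lambda>i. x i + y i) = (\<lambda>i. act f x i + act f y i)"
  by (induction f) (auto simp: act_pCons add algebra_simps)

lemma act_sum_vec: "act f (\<lambda>i. \<Sum>k\<in>K. y k i) = (\<lambda>i. \<Sum>k\<in>K. act f (y k) i)"
  by (induction K rule: infinite_finite_induct) (auto simp: act_zero_vec act_add_vec)

end

text \<open>Outputs vanish beyond the last row, so that identities between vectors hold as
  equalities of functions.\<close>

definition mat_op :: "'a::comm_ring_1 mat \<Rightarrow> (nat \<Rightarrow> 'a) \<Rightarrow> nat \<Rightarrow> 'a" where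
  "mat_op A x = (\<lambda>i. if i < dim_row A then \<Sum>j<dim_col A. A $$ (i, j) * x j else 0)"

interpretation mat_op: linear_operator "mat_op A"
  by unfold_locales
    (auto simp: mat_op_def fun_eq_iff sum.distrib distrib_left sum_distrib_left mult.left_commute)

abbreviation std_basis :: "nat \<Rightarrow> nat \<Rightarrow> 'a::comm_ring_1" where
  "std_basis j \<equiv> (\<lambda>i. if i = j then 1 else 0)"

lemma mat_op_std_basis:
  assumes "A \<in> carrier_mat n n" "j < n"
  shows "mat_op A (std_basis j) = (\<lambda>i. if i < n then A $$ (i, j) else 0)"
  using assms by (auto simp: mat_op_def fun_eq_iff if_distrib[of "(*) _"] cong: if_cong)

lemma mat_op_mult:
  assumes "A \<in> carrier_mat n n" "B \<in> carrier_mat n n"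
  shows "mat_op (A * B) x = mat_op A (mat_op B x)"
proof
  fix i
  show "mat_op (A * B) x i = mat_op A (mat_op B x) i"
  proof (cases "i < n")
    case True
    have "(\<Sum>j<n. (\<Sum>k<n. A $$ (i, k) * B $$ (k, j)) * x j)
        = (\<Sum>k<n. A $$ (i, k) * (\<Sum>j<n. B $$ (k, j) * x j))"
      by (simp add: sum_distrib_left sum_distrib_right mult.assoc)
        (rule sum.swap)
    with True assms show ?thesis
      by (simp add: mat_op_def scalar_prod_def lessThan_atLeast0)
  qed (use assms in \<open>simp add: mat_op_def\<close>)
qed

lemma mat_op_pow:
  assumes "A \<in> carrier_mat n n" "j < n" "i < n"
  shows "(mat_op A ^^ k) (std_basis j) i = (A ^\<^sub>m k) $$ (i, j)"
proof -
  have "mat_op (A ^\<^sub>m k) (std_basis j) = (mat_op A ^^ k) (std_basis j)"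
  proof (induction k)
    case 0
    show ?case
      using assms by (auto simp: mat_op_std_basis[of _ n] fun_eq_iff)
  next
    case (Suc k)
    \<comment> \<open>Matrix powers grow by a factor on the right, iterates of
      \<open>mat_op A\<close> by one on the left.\<close>
    have comm: "A ^\<^sub>m k * A = A * A ^\<^sub>m k"
    proof (induction k)
      case (Suc k)
      have "A ^\<^sub>m Suc k * A = (A * A ^\<^sub>m k) * A"
        using Suc by simp
      also have "\<dots> = A * A ^\<^sub>m Suc k"
        using assms(1) by (simp add: assoc_mult_mat[of _ n n _ n _ n])
      finally show ?case .
    qed (use assms in simp)
    then have "mat_op (A ^\<^sub>m Suc k) (std_basis j)
        = mat_op A (mat_op (A ^\<^sub>m k) (std_basis j))"
      using assms(1) by (simp add: mat_op_mult[of _ n])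
    with Suc show ?case by simp
  qed
  with assms show ?thesis
    by (metis mat_op_std_basis pow_carrier_mat)
qed

lemma poly_mat_eval_carrier [simp]:
  "A \<in> carrier_mat n n \<Longrightarrow> poly_mat_eval f A \<in> carrier_mat n n"
  unfolding poly_mat_eval_def by auto

text \<open>Column \<open>j\<close> of \<open>f(A)\<close> is \<open>f(A)\<close> applied to the
  \<open>j\<close>-th basis vector; this carries results on \<open>act\<close> over to
  matrices.\<close>

lemma poly_mat_eval_index:
  assumes "A \<in> carrier_mat n n" "i < n" "j < n"
  shows "poly_mat_eval f A $$ (i, j) = mat_op.act A f (std_basis j) i"
  using assms by (simp add: poly_mat_eval_def mat_op.act_def mat_op_pow[of _ n])

text \<open>Cayley--Hamilton: apply the matrix \<open>adj (X I - A)\<close> over the polynomial ring to the relations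
  \<open>\<Sum>i. (X \<delta>\<^sub>i\<^sub>j - A\<^sub>i\<^sub>j) e\<^sub>i = 0\<close>, where \<open>X\<close> acts as \<open>A\<close>.\<close>

lemma act_char_poly_eq_0:
  fixes A :: "'a::idom mat"
  assumes A: "A \<in> carrier_mat n n" and k: "k < n"
  shows "mat_op.act A (char_poly A) (std_basis k) = (\<lambda>i. 0)"
proof
  fix r
  define M where "M = char_poly_matrix A"
  define N where "N = adj_mat M"
  have M: "M \<in> carrier_mat n n" using A by (simp add: M_def)
  have N: "N \<in> carrier_mat n n" using adj_mat(1)[OF M] by (simp add: N_def)
  have M_index: "M $$ (i, j) = [:- A $$ (i, j), if i = j then 1 else 0:]" if "i < n" "j < n" for i j
    using that A by (simp add: M_def char_poly_matrix_def)
  have MN: "(\<Sum>j<n. M $$ (i, j) * N $$ (j, k)) = (if i = k then char_poly A else 0)"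
    if i: "i < n" for i
  proof -
    have "(\<Sum>j<n. M $$ (i, j) * N $$ (j, k)) = (M * N) $$ (i, k)"
      using i k M N by (simp add: scalar_prod_def lessThan_atLeast0)
    also have "M * N = det M \<cdot>\<^sub>m 1\<^sub>m n"
      unfolding N_def by (rule adj_mat(2)[OF M])
    finally show ?thesis using i k by (auto simp: char_poly_def M_def)
  qed
  have relation: "(\<lambda>r. \<Sum>i<n. mat_op.act A (M $$ (i, j)) (std_basis i) r) = (\<lambda>r. 0)"
    if j: "j < n" for j
  proof
    fix r
    have "(\<Sum>i<n. mat_op.act A (M $$ (i, j)) (std_basis i) r)
        = (\<Sum>i<n. (if i = r then - A $$ (i, j) else 0)
            + (if i = j then mat_op A (std_basis i) r else 0))"
      by (rule sum.cong)
        (auto simp: M_index j mat_op.act_pCons mat_op.zero)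
    also have "\<dots> = 0"
      using A j by (auto simp: sum.distrib mat_op_std_basis)
    finally show "(\<Sum>i<n. mat_op.act A (M $$ (i, j)) (std_basis i) r) = 0" .
  qed
  \<comment> \<open>Applying \<open>N $$ (j, k)\<close> to the \<open>j\<close>-th relation and
    summing over \<open>j\<close> leaves column \<open>k\<close> of \<open>M * N\<close>, a scalar
    matrix, acting on the basis vectors; only the \<open>k\<close>-th one survives.\<close>
  have "0 = (\<Sum>j<n. mat_op.act A (N $$ (j, k))
      (\<lambda>r. \<Sum>i<n. mat_op.act A (M $$ (i, j)) (std_basis i) r) r)"
    by (simp add: relation mat_op.act_zero_vec)
  also have "\<dots> = (\<Sum>j<n. \<Sum>i<n. mat_op.act A (M $$ (i, j) * N $$ (j, k)) (std_basis i) r)"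
    by (simp add: mat_op.act_sum_vec mat_op.act_mult[symmetric] mult.commute)
  also have "\<dots> = (\<Sum>i<n. mat_op.act A (\<Sum>j<n. M $$ (i, j) * N $$ (j, k)) (std_basis i) r)"
    by (subst sum.swap) (simp add: mat_op.act_poly_sum)
  also have "\<dots> = (\<Sum>i<n. if i = k then mat_op.act A (char_poly A) (std_basis k) r else 0)"
    by (rule sum.cong) (auto simp: MN)
  also have "\<dots> = mat_op.act A (char_poly A) (std_basis k) r"
    using k by simp
  finally show "mat_op.act A (char_poly A) (std_basis k) r = 0" by simp
qed

section \<open>Companion matrices\<close>

lemma companion_mat_carrier [simp]: "companion_mat n p \<in> carrier_mat n n"
  by (simp add: companion_mat_def)

text \<open>The subdiagonal ones move each basis vector to the next, so the zeroth is a cyclic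
  vector.\<close>

lemma companion_pow_std_basis:
  assumes "k < n"
  shows "(mat_op (companion_mat n p) ^^ k) (std_basis 0) = std_basis k"
  using assms
proof (induction k)
  case (Suc k)
  let ?C = "companion_mat n p"
  have "(mat_op ?C ^^ Suc k) (std_basis 0) = mat_op ?C (std_basis k)"
    using Suc by simp
  also have "\<dots> = std_basis (Suc k)"
    using Suc.prems by (subst mat_op_std_basis[of _ n]) (auto simp: companion_mat_def fun_eq_iff)
  finally show ?case .
qed simp

lemma act_companion_of_degree_less:
  assumes "degree r < n"
  shows "mat_op.act (companion_mat n p) r (std_basis 0) i = coeff r i"
proof -
  have "mat_op.act (companion_mat n p) r (std_basis 0) i
      = (\<Sum>k\<le>degree r. if k = i then coeff r k else 0)"
    unfolding mat_op.act_def
    by (rule sum.cong) (use assms in \<open>auto simp: companion_pow_std_basis\<close>)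
  then show ?thesis by (simp add: coeff_eq_0)
qed

text \<open>The \<open>n\<close>-th power of the companion matrix sends the zeroth basis vector to
  the last column, whose negated coefficients of \<open>p\<close> cancel the terms of degree below
  \<open>n\<close>.\<close>

lemma act_companion_self:
  assumes "n \<ge> 1" "lead_coeff p = 1" "degree p = n"
  shows "mat_op.act (companion_mat n p) p (std_basis 0) = (\<lambda>i. 0)"
proof
  fix i
  obtain m where n: "n = Suc m" using assms(1) by (cases n) auto
  let ?C = "companion_mat n p"
  have "mat_op.act ?C p (std_basis 0) i
      = (\<Sum>k\<le>m. coeff p k * (mat_op ?C ^^ k) (std_basis 0) i)
        + mat_op ?C ((mat_op ?C ^^ m) (std_basis 0)) i"
    using assms by (simp add: mat_op.act_def n)
  also have "(\<Sum>k\<le>m. coeff p k * (mat_op ?C ^^ k) (std_basis 0) i)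
      = (\<Sum>k\<le>m. if k = i then coeff p k else 0)"
    by (rule sum.cong) (auto simp: companion_pow_std_basis n)
  also have "mat_op ?C ((mat_op ?C ^^ m) (std_basis 0)) i = (if i < n then - coeff p i else 0)"
    by (simp add: companion_pow_std_basis n mat_op_std_basis[of _ "Suc m"])
      (simp add: companion_mat_def)
  finally show "mat_op.act ?C p (std_basis 0) i = 0" by (simp add: n less_Suc_eq_le)
qed

section \<open>The ideal generated by a polynomial \<open>p\<close> and a constant
  \<open>d\<close>\<close>

definition in_ideal2 :: "'a::comm_ring_1 \<Rightarrow> 'a poly \<Rightarrow> 'a poly \<Rightarrow> bool" where
  "in_ideal2 d p g \<longleftrightarrow> (\<exists>q w. g = q * p + smult d w)"

lemma smult_of_dvd_coeffs:
  assumes "\<And>i. d dvd coeff r i"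
  shows "\<exists>w. r = smult d w"
  using assms
proof (induction r)
  case 0
  show ?case by (rule exI[of _ 0]) simp
next
  case (pCons a r)
  from pCons.prems[of 0] obtain b where "a = d * b" by (auto elim: dvdE)
  moreover have "d dvd coeff r i" for i using pCons.prems[of "Suc i"] by simp
  then obtain w where "r = smult d w" using pCons.IH by blast
  ultimately have "pCons a r = smult d (pCons b w)" by simp
  then show ?case by blast
qed

lemma in_ideal2_of_companion:
  fixes p :: "'a::idom poly"
  assumes n: "n \<ge> 1" and p: "lead_coeff p = 1" "degree p = n"
    and dvd: "\<And>i. i < n \<Longrightarrow> d dvd poly_mat_eval g (companion_mat n p) $$ (i, 0)"
  shows "in_ideal2 d p g"
proof -
  have p0: "p \<noteq> 0" using p by auto
  \<comment> \<open>As \<open>p\<close> is monic, the power of its leading coefficient in the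
    pseudo-division is 1, and this is ordinary division with remainder.\<close>
  obtain q r where "pseudo_divmod g p = (q, r)" by fastforce
  from pseudo_divmod[OF p0 this] p n have g: "g = p * q + r" and r: "degree r < n"
    by auto
  have "d dvd coeff r i" for i
  proof (cases "i < n")
    case True
    have "mat_op.act (companion_mat n p) g (std_basis 0) i = coeff r i"
      using act_companion_of_degree_less[OF r, of p i] act_companion_self[OF n p]
      by (simp add: g mat_op.act_add mult.commute[of p] mat_op.act_mult mat_op.act_zero_vec)
    with dvd[OF True] True n show ?thesis
      by (simp add: poly_mat_eval_index[of _ n])
  qed (use r in \<open>simp add: coeff_eq_0\<close>)
  then obtain w where "r = smult d w" using smult_of_dvd_coeffs by blast
  with g show ?thesis unfolding in_ideal2_def by (metis mult.commute)
qed

text \<open>By Cayley--Hamilton the multiple of \<open>char_poly A\<close> annihilates every basis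
  vector, which leaves \<open>d\<close> times an entry of \<open>w(A)\<close>.\<close>

lemma dvd_eval_of_in_ideal2_char_poly:
  fixes A :: "'a::idom mat"
  assumes "in_ideal2 d (char_poly A) g" "A \<in> carrier_mat n n" "i < n" "j < n"
  shows "d dvd poly_mat_eval g A $$ (i, j)"
proof -
  from assms(1) obtain q w where "g = q * char_poly A + smult d w"
    unfolding in_ideal2_def by blast
  then show ?thesis
    using assms(2-4)
    by (simp add: poly_mat_eval_index[of _ n] mat_op.act_add mat_op.act_mult mat_op.act_smult
        act_char_poly_eq_0 mat_op.act_zero_vec)
qed

text \<open>With \<open>p' = p + d s\<close>, the change of \<open>p\<close> is absorbed by the
  multiple of \<open>d\<close>: \<open>q p' + d w = q p + d (q s + w)\<close>.\<close>

lemma in_ideal2_cong: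
  assumes "in_ideal2 d p' g" "\<And>k. d dvd coeff p' k - coeff p k"
  shows "in_ideal2 d p g"
proof -
  obtain s where s: "p' - p = smult d s"
    using smult_of_dvd_coeffs[of d "p' - p"] assms(2) by auto
  obtain q w where "g = q * p' + smult d w"
    using assms(1) unfolding in_ideal2_def by blast
  also have "p' = p + smult d s" using s by (simp add: algebra_simps)
  finally have "g = q * p + smult d (q * s + w)"
    by (simp add: algebra_simps smult_add_right)
  then show ?thesis unfolding in_ideal2_def by blast
qed

section \<open>Clearing denominators\<close>

lemma to_fract_sum: "to_fract (\<Sum>k\<in>K. f k) = (\<Sum>k\<in>K. to_fract (f k))"
  by (induction K rule: infinite_finite_induct) (auto simp: to_fract_add)

lemma to_fract_hom: "comm_ring_hom (to_fract :: 'a::idom \<Rightarrow> 'a fract)"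
  by unfold_locales (auto simp: to_fract_add to_fract_mult to_fract_uminus)

lemma ex_common_denominator:
  fixes f :: "'a::idom fract poly"
  shows "\<exists>d g. d \<noteq> 0 \<and> (\<forall>k. to_fract d * coeff f k = to_fract (coeff g k))"
proof (induction f)
  case 0
  show ?case by (rule exI[of _ 1], rule exI[of _ 0]) simp
next
  case (pCons a f)
  then obtain d g where d: "d \<noteq> 0" "\<And>k. to_fract d * coeff f k = to_fract (coeff g k)" by blast
  obtain x y where xy: "a = Fract x y" "y \<noteq> 0" by (cases a) auto
  have a: "to_fract y * a = to_fract x"
    using xy by (simp add: to_fract_def eq_fract)
  have "to_fract (d * y) * coeff (pCons a f) k
      = to_fract (coeff (pCons (d * x) (smult y g)) k)" for k
  proof (cases k)
    case 0
    have "to_fract (d * y) * a = to_fract d * (to_fract y * a)" by simp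
    with 0 a show ?thesis by simp
  next
    case (Suc k')
    have "to_fract (d * y) * coeff f k' = to_fract y * (to_fract d * coeff f k')" by simp
    with Suc d(2)[of k'] show ?thesis by simp
  qed
  moreover have "d * y \<noteq> 0" using d xy by simp
  ultimately show ?case by blast
qed

lemma map_mat_to_fract_pow:
  assumes "C \<in> carrier_mat n n"
  shows "map_mat to_fract (C ^\<^sub>m k) = (map_mat to_fract C ^\<^sub>m k :: 'a::idom fract mat)"
proof -
  interpret comm_ring_hom "to_fract :: 'a \<Rightarrow> 'a fract" by (rule to_fract_hom)
  show ?thesis by (rule mat_hom_pow[OF assms])
qed

lemma poly_mat_eval_clear_denominator:
  assumes C: "C \<in> carrier_mat n n" "i < n" "j < n"
    and d: "\<And>k. to_fract d * coeff f k = to_fract (coeff g k)"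
  shows "to_fract d * poly_mat_eval f (map_mat to_fract C) $$ (i, j)
    = to_fract (poly_mat_eval g C $$ (i, j))"
proof -
  let ?N = "max (degree f) (degree g)"
  let ?C = "map_mat to_fract C"
  have eval: "poly_mat_eval h B $$ (i, j) = (\<Sum>k\<le>?N. coeff h k * (B ^\<^sub>m k) $$ (i, j))"
    if "B \<in> carrier_mat n n" "degree h \<le> ?N" for h and B :: "'b::comm_ring_1 mat"
    using that C mat_op.act_eq[OF that(2), of B "std_basis j" i]
    by (simp add: poly_mat_eval_index[of _ n] mat_op_pow[of _ n])
  have "to_fract d * poly_mat_eval f ?C $$ (i, j)
      = (\<Sum>k\<le>?N. (to_fract d * coeff f k) * (?C ^\<^sub>m k) $$ (i, j))"
    using C by (simp add: eval sum_distrib_left mult.assoc)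
  also have "\<dots> = to_fract (\<Sum>k\<le>?N. coeff g k * (C ^\<^sub>m k) $$ (i, j))"
    unfolding d to_fract_sum to_fract_mult map_mat_to_fract_pow[OF C(1), symmetric]
    using C by simp
  finally show ?thesis using C by (simp add: eval)
qed

text \<open>An entry of \<open>f(C)\<close> is the entry of \<open>g(C)\<close> divided by
  \<open>d\<close>, hence lies in the domain exactly when \<open>d\<close> divides the
  latter.\<close>

lemma IntK_iff_dvd:
  fixes S :: "'a::idom mat set"
  assumes S: "S \<subseteq> carrier_mat n n" and d0: "d \<noteq> 0"
    and d: "\<And>k. to_fract d * coeff f k = to_fract (coeff g k)"
  shows "f \<in> IntK n S \<longleftrightarrow> (\<forall>C\<in>S. \<forall>i<n. \<forall>j<n. d dvd poly_mat_eval g C $$ (i, j))"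
proof -
  have "poly_mat_eval f (map_mat to_fract C) \<in> Mn_D_in_K n
      \<longleftrightarrow> (\<forall>i<n. \<forall>j<n. d dvd poly_mat_eval g C $$ (i, j))" if "C \<in> S" for C
  proof -
    let ?E = "poly_mat_eval f (map_mat to_fract C)"
    from that S have C: "C \<in> carrier_mat n n" by blast
    then have E: "?E \<in> carrier_mat n n" by simp
    note clear = poly_mat_eval_clear_denominator[OF C _ _ d]
    show ?thesis
    proof (intro iffI allI impI)
      fix i j
      assume "?E \<in> Mn_D_in_K n" and ij: "i < n" "j < n"
      then obtain B where B: "B \<in> carrier_mat n n" "?E = map_mat to_fract B"
        unfolding Mn_D_in_K_def by (elim imageE)
      have "to_fract (d * B $$ (i, j)) = to_fract (poly_mat_eval g C $$ (i, j))"
        using clear[OF ij] B ij by simp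
      then have "poly_mat_eval g C $$ (i, j) = d * B $$ (i, j)"
        by (metis to_fract_eq_iff)
      then show "d dvd poly_mat_eval g C $$ (i, j)" by simp
    next
      assume dvd: "\<forall>i<n. \<forall>j<n. d dvd poly_mat_eval g C $$ (i, j)"
      define b where "b i j = (SOME b. poly_mat_eval g C $$ (i, j) = d * b)" for i j
      have b: "poly_mat_eval g C $$ (i, j) = d * b i j" if "i < n" "j < n" for i j
        unfolding b_def by (rule someI_ex) (use dvd that in \<open>simp add: dvd_def\<close>)
      have "?E $$ (i, j) = to_fract (b i j)" if "i < n" "j < n" for i j
        using clear[OF that] b[OF that] d0 by simp
      then have "?E = map_mat to_fract (mat n n (\<lambda>(i, j). b i j))"
        using E by (intro eq_matI) auto
      then show "?E \<in> Mn_D_in_K n" unfolding Mn_D_in_K_def by auto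
    qed
  qed
  then show ?thesis unfolding IntK_def by blast
qed

text \<open>Both claims reduce to this criterion: the test set only has to force \<open>g\<close>
  into \<open>(p, d)\<close> for each monic \<open>p\<close> of degree \<open>n\<close>. Taking the
  characteristic polynomial for \<open>p\<close> then covers an arbitrary matrix.\<close>

lemma IntK_subset_of_in_ideal2:
  fixes S :: "'a::idom mat set"
  assumes n: "n \<ge> 1" and S: "S \<subseteq> carrier_mat n n"
    and step: "\<And>(d::'a) g p. \<lbrakk>d \<noteq> 0; lead_coeff p = 1; degree p = n;
        \<forall>C\<in>S. \<forall>i<n. \<forall>j<n. d dvd poly_mat_eval g C $$ (i, j)\<rbrakk> \<Longrightarrow> in_ideal2 d p g"
  shows "IntK n (carrier_mat n n) = IntK n S"
proof
  show "IntK n (carrier_mat n n) \<subseteq> IntK n S"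
    using S unfolding IntK_def by blast
  show "IntK n S \<subseteq> IntK n (carrier_mat n n)"
  proof
    fix f assume f: "f \<in> IntK n S"
    obtain d g where d: "d \<noteq> 0" "\<And>k. to_fract d * coeff f k = to_fract (coeff g k)"
      using ex_common_denominator[of f] by blast
    have "\<forall>C\<in>S. \<forall>i<n. \<forall>j<n. d dvd poly_mat_eval g C $$ (i, j)"
      using f IntK_iff_dvd[OF S d] by blast
    then have "in_ideal2 d (char_poly A) g" if "A \<in> carrier_mat n n" for A
      using degree_monic_char_poly[OF that] by (intro step d(1)) auto
    then show "f \<in> IntK n (carrier_mat n n)"
      using IntK_iff_dvd[OF order_refl d] dvd_eval_of_in_ideal2_char_poly by blast
  qed
qed

section \<open>Monic polynomials without factors of a given degree\<close>

lemma is_ideal_sum: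
  assumes "is_ideal P" "\<And>k. k \<in> K \<Longrightarrow> f k \<in> P"
  shows "(\<Sum>k\<in>K. f k) \<in> P"
  using assms by (induction K rule: infinite_finite_induct) (auto simp: is_ideal_def)

lemma is_ideal_uminus:
  assumes "is_ideal P" "x \<in> P"
  shows "- x \<in> P"
proof -
  have "(- 1) * x \<in> P" using assms unfolding is_ideal_def by blast
  then show ?thesis by simp
qed

lemma is_ideal_add: "is_ideal P \<Longrightarrow> x \<in> P \<Longrightarrow> y \<in> P \<Longrightarrow> x + y \<in> P"
  by (auto simp: is_ideal_def)

lemma is_ideal_mult: "is_ideal P \<Longrightarrow> x \<in> P \<Longrightarrow> r * x \<in> P"
  by (auto simp: is_ideal_def)

lemma is_ideal_diff: "is_ideal P \<Longrightarrow> x \<in> P \<Longrightarrow> y \<in> P \<Longrightarrow> x - y \<in> P"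
  using is_ideal_add[of P x "- y"] is_ideal_uminus[of P y] by simp

lemma coeff_mult_cong_ideal:
  assumes P: "is_ideal P"
    and a: "\<And>k. coeff a k - coeff a' k \<in> P" and b: "\<And>k. coeff b k - coeff b' k \<in> P"
  shows "coeff (a * b) k - coeff (a' * b') k \<in> P"
proof -
  have "coeff (a * b) k - coeff (a' * b') k
      = (\<Sum>i\<le>k. coeff b (k - i) * (coeff a i - coeff a' i)
          + coeff a' i * (coeff b (k - i) - coeff b' (k - i)))"
    by (simp add: coeff_mult sum_subtractf[symmetric] algebra_simps)
  also have "\<dots> \<in> P"
    by (intro is_ideal_sum[OF P] is_ideal_add[OF P] is_ideal_mult[OF P] a b)
  finally show ?thesis .
qed

text \<open>One representative is chosen per residue class, so that finitely many ring elements
  stand in for the quotient ring.\<close>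

lemma ex_ideal_representatives:
  fixes P :: "'a::comm_ring_1 set"
  assumes P: "is_ideal P" and fin: "finite_index P"
  shows "\<exists>\<rho>::'a \<Rightarrow> 'a. finite (range \<rho>) \<and> (\<forall>x. x - \<rho> x \<in> P) \<and> (\<forall>x y. x - y \<in> P \<longrightarrow> \<rho> x = \<rho> y)"
proof -
  define R where "R = {(x, y). x - y \<in> P}"
  define \<rho> where "\<rho> x = (SOME y. y \<in> R `` {x})" for x
  have "x - \<rho> x \<in> P" for x
  proof -
    have "x \<in> R `` {x}" using P by (auto simp: R_def is_ideal_def)
    then have "\<rho> x \<in> R `` {x}" unfolding \<rho>_def by (rule someI)
    then show ?thesis by (simp add: R_def)
  qed
  moreover have "\<rho> x = \<rho> y" if xy: "x - y \<in> P" for x y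
  proof -
    have "x - z \<in> P \<longleftrightarrow> y - z \<in> P" for z
      using is_ideal_diff[OF P _ xy, of "x - z"] is_ideal_add[OF P _ xy, of "y - z"] by auto
    then have "R `` {x} = R `` {y}" by (auto simp: R_def)
    then show ?thesis by (simp add: \<rho>_def)
  qed
  moreover have "range \<rho> \<subseteq> (\<lambda>S. SOME y. y \<in> S) ` (UNIV // R)"
    unfolding \<rho>_def by (intro image_subsetI imageI) (rule quotientI, simp)
  then have "finite (range \<rho>)"
    using fin finite_surj unfolding finite_index_def R_def by blast
  ultimately show ?thesis by blast
qed

definition monic_of :: "nat \<Rightarrow> (nat \<Rightarrow> 'a) \<Rightarrow> 'a::comm_ring_1 poly" where
  "monic_of m u = monom 1 m + (\<Sum>k<m. monom (u k) k)"

lemma coeff_monic_of: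
  "coeff (monic_of m u) k = (if k < m then u k else if k = m then 1 else 0)"
  by (auto simp: monic_of_def coeff_sum)

lemma monic_of_degree: "degree (monic_of m u) = m" "lead_coeff (monic_of m u) = 1"
proof -
  show "degree (monic_of m u) = m"
    by (intro antisym degree_le le_degree) (auto simp: coeff_monic_of)
  then show "lead_coeff (monic_of m u) = 1" by (simp add: coeff_monic_of)
qed

text \<open>Modulo \<open>P\<close>, there are as many pairs of monic polynomials of degrees \<open>i\<close> and \<open>n - i\<close> as monic
  polynomials of degree \<open>n\<close>. As \<open>x\<^sup>i \<cdot> x\<^sup>n\<^sup>-\<^sup>i\<^sup>-\<^sup>1(x + 1) = x\<^sup>i\<^sup>-\<^sup>1(x + 1) \<cdot> x\<^sup>n\<^sup>-\<^sup>i\<close>, multiplication is not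
  injective, hence not surjective.\<close>

lemma ex_monic_without_factor_of_degree:
  fixes P :: "'a::idom set"
  assumes P: "is_ideal P" and fin: "finite_index P" and one: "1 \<notin> P"
    and i: "1 \<le> i" "i < n"
  shows "\<exists>h. lead_coeff h = 1 \<and> degree h = n \<and>
    (\<forall>a b. lead_coeff a = 1 \<and> degree a = i \<and> lead_coeff b = 1 \<and> degree b = n - i \<longrightarrow>
      \<not> (\<forall>k. coeff (a * b) k - coeff h k \<in> P))"
proof (rule ccontr)
  assume neg: "\<not> ?thesis"
  obtain \<rho> :: "'a \<Rightarrow> 'a" where fin_\<rho>: "finite (range \<rho>)" and \<rho>: "\<And>x. x - \<rho> x \<in> P"
    and \<rho>_eq: "\<And>x y. x - y \<in> P \<Longrightarrow> \<rho> x = \<rho> y"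
    using ex_ideal_representatives[OF P fin] by blast
  have \<rho>_idem: "\<rho> (\<rho> x) = \<rho> x" for x using \<rho>_eq[OF \<rho>, of x] by simp
  \<comment> \<open>\<open>V m\<close> encodes the monic polynomials of degree \<open>m\<close>
    modulo \<open>P\<close> by their lower coefficients, and \<open>red m\<close> maps such a
    polynomial to its code.\<close>
  define V where "V m = PiE {..<m} (\<lambda>_. range \<rho>)" for m :: nat
  define red where "red m a = restrict (\<lambda>k. \<rho> (coeff a k)) {..<m}" for m and a :: "'a poly"
  have fin_V: "finite (V m)" and card_V: "card (V m) = card (range \<rho>) ^ m" for m
    using fin_\<rho> by (auto simp: V_def card_PiE intro: finite_PiE)
  have red_V: "red m a \<in> V m" for m a by (auto simp: red_def V_def)
  have red_monic: "coeff a k - coeff (monic_of m (red m a)) k \<in> P"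
    if "lead_coeff a = 1" "degree a = m" for a m k
    using that \<rho> P by (auto simp: coeff_monic_of red_def coeff_eq_0 is_ideal_def)
  \<comment> \<open>Multiplication of residue classes, read on the codes.\<close>
  define F where "F = (\<lambda>(u, v). red n (monic_of i u * monic_of (n - i) v))"
  have F_red: "F (red i a, red (n - i) b) = red n (a * b)"
    if "lead_coeff a = 1" "degree a = i" "lead_coeff b = 1" "degree b = n - i" for a b
  proof -
    have "\<rho> (coeff (a * b) k)
        = \<rho> (coeff (monic_of i (red i a) * monic_of (n - i) (red (n - i) b)) k)" for k
      by (intro \<rho>_eq coeff_mult_cong_ideal[OF P] red_monic that)
    then show ?thesis unfolding F_def red_def by (auto simp: fun_eq_iff)
  qed
  \<comment> \<open>By the negated claim every monic polynomial of degree \<open>n\<close> is a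
    product modulo \<open>P\<close>, so \<open>F\<close> is surjective.\<close>
  have "V n \<subseteq> F ` (V i \<times> V (n - i))"
  proof
    fix w assume w: "w \<in> V n"
    let ?h = "monic_of n w"
    have red_h: "red n ?h = w"
    proof
      fix k
      show "red n ?h k = w k"
      proof (cases "k < n")
        case True
        with w obtain x where "w k = \<rho> x" by (auto simp: V_def)
        with True show ?thesis by (simp add: red_def coeff_monic_of \<rho>_idem)
      next
        case False
        with PiE_arb[OF w[unfolded V_def], of k] show ?thesis by (simp add: red_def)
      qed
    qed
    obtain a b where ab: "lead_coeff a = 1" "degree a = i" "lead_coeff b = 1" "degree b = n - i"
      and h: "\<And>k. coeff (a * b) k - coeff ?h k \<in> P"
      using neg[unfolded not_ex, THEN spec, of ?h] monic_of_degree[of n w] by metis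
    have "red n (a * b) = w"
      using \<rho>_eq[OF h] by (subst red_h[symmetric]) (simp add: red_def)
    then have "F (red i a, red (n - i) b) = w" using F_red[OF ab] by simp
    then show "w \<in> F ` (V i \<times> V (n - i))" using red_V by blast
  qed
  moreover have "F ` (V i \<times> V (n - i)) \<subseteq> V n" by (auto simp: F_def red_V)
  ultimately have "F ` (V i \<times> V (n - i)) = V n" by blast
  moreover have "card (V i \<times> V (n - i)) = card (V n)"
    using i by (simp add: card_cartesian_product card_V flip: power_add)
  ultimately have inj: "inj_on F (V i \<times> V (n - i))"
    using fin_V by (intro eq_card_imp_inj_on) auto
  \<comment> \<open>The predecessors of \<open>i\<close> and \<open>n - i\<close> compensate for the
    factor \<open>x + 1\<close> in \<open>Y\<close>.\<close>
  obtain j where j: "i = Suc j" using i by (cases i) auto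
  obtain l where l: "n - i = Suc l" using i by (cases "n - i") auto
  define X :: "nat \<Rightarrow> 'a poly" where "X m = monom 1 m" for m
  define Z :: "'a poly" where "Z = [:1, 1:]"
  define Y :: "nat \<Rightarrow> 'a poly" where "Y m = X m * Z" for m
  have Z: "Z \<noteq> 0" "degree Z = 1" "lead_coeff Z = 1" by (simp_all add: Z_def)
  have X: "degree (X m) = m" "lead_coeff (X m) = 1" for m
    by (simp_all add: X_def degree_monom_eq)
  have Y: "degree (Y m) = Suc m" "lead_coeff (Y m) = 1" for m
  proof -
    have "X m \<noteq> 0" using X(2)[of m] by auto
    then show "degree (Y m) = Suc m" using X(1)[of m] Z by (simp add: Y_def degree_mult_eq)
    show "lead_coeff (Y m) = 1" unfolding Y_def lead_coeff_mult X(2) Z(3) by simp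
  qed
  have Y': "degree (Y l) = n - i" "degree (Y j) = i" using Y(1) j l by simp_all
  have "X i * Y l = Y j * X (n - i)"
  proof -
    have "i + l = j + (n - i)" using j l by linarith
    then have "X i * X l = X j * X (n - i)" by (simp add: X_def mult_monom)
    then show ?thesis by (simp add: Y_def mult_ac)
  qed
  then have "F (red i (X i), red (n - i) (Y l)) = F (red i (Y j), red (n - i) (X (n - i)))"
    using F_red[OF X(2,1) Y(2) Y'(1)] F_red[OF Y(2) Y'(2) X(2,1)] by simp
  then have "red i (X i) = red i (Y j)"
    using inj_onD[OF inj] red_V by blast
  \<comment> \<open>The coefficient at \<open>j = i - 1\<close> tells the two factors apart: it is 0
    in \<open>X i\<close> and 1 in \<open>Y j\<close>.\<close>
  then have "red i (X i) j = red i (Y j) j" by (rule fun_cong)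
  then have "\<rho> (coeff (X i) j) = \<rho> (coeff (Y j) j)"
    by (simp add: red_def j)
  then have "\<rho> 0 = \<rho> 1"
    by (simp add: X_def Y_def Z_def j coeff_pCons split: nat.splits)
  then have "1 - 0 \<in> P"
    using is_ideal_diff[OF P \<rho>[of 1] \<rho>[of 0]] by simp
  with one show False by simp
qed

section \<open>Irreducible polynomials in a residue class\<close>

text \<open>The leading coefficients of two factors of a monic polynomial are inverse units. Hence
  constant factors are units, and any other factorization can be rescaled to monic factors.\<close>

lemma irreducible_monicI:
  fixes p :: "'a::idom poly"
  assumes n: "n \<ge> 1" and p: "lead_coeff p = 1" "degree p = n"
    and nofac: "\<And>i a b. \<lbrakk>1 \<le> i; i < n; lead_coeff a = 1; degree a = i; lead_coeff b = 1;
        degree b = n - i\<rbrakk> \<Longrightarrow> p \<noteq> a * b"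
  shows "irreducible p"
proof (rule irreducibleI)
  show p0: "p \<noteq> 0" using p by auto
  show "\<not> p dvd 1" using p n by (auto dest: dvd_imp_degree_le)
  fix a b assume ab: "p = a * b"
  have lc: "lead_coeff a * lead_coeff b = 1" using p ab lead_coeff_mult[of a b] by simp
  have nz: "a \<noteq> 0" "b \<noteq> 0" using ab p0 by auto
  have deg: "degree a + degree b = n" using degree_mult_eq[OF nz] ab p by simp
  have unit: "c dvd 1" if "degree c = 0" "lead_coeff c dvd 1" for c :: "'a poly"
    using that by (metis degree_eq_zeroE coeff_pCons_0 is_unit_const_poly_iff)
  consider "degree a = 0" | "degree b = 0" | "degree a \<ge> 1" "degree a < n"
    using deg by linarith
  then show "a dvd 1 \<or> b dvd 1"
  proof cases
    case 1
    then show ?thesis using unit[of a] lc by (metis dvdI)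
  next
    case 2
    then show ?thesis using unit[of b] lc by (metis dvdI mult.commute)
  next
    case 3
    let ?a = "smult (lead_coeff b) a" and ?b = "smult (lead_coeff a) b"
    have "?a * ?b = smult (lead_coeff a * lead_coeff b) (a * b)"
      by (simp add: mult.commute)
    then have "p = ?a * ?b" using ab lc by simp
    moreover have "lead_coeff ?a = 1" "lead_coeff ?b = 1" "degree ?a = degree a"
      "degree ?b = n - degree a"
      using nz lc deg by (auto simp: mult.commute)
    ultimately show ?thesis using nofac[OF 3] by blast
  qed
qed

text \<open>One ideal is spent on each factor degree; a nonzero element of it is multiplied into the
  modulus \<open>e\<close>, so that later modifications of \<open>q\<close> keep its residues modulo the earlier ideals.\<close>

lemma ex_monic_without_factors_upto:
  fixes d :: "'a::idom"
  assumes ideals: "\<And>e. \<lbrakk>e \<noteq> 0; d dvd e\<rbrakk> \<Longrightarrow> \<exists>P. is_ideal P \<and> finite_index P \<and> 1 \<notin> P \<and>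
      (\<exists>s\<in>P. \<exists>t. s + t * e = 1) \<and> (\<exists>z\<in>P. z \<noteq> 0)"
    and p: "lead_coeff p = 1" "degree p = n" and d: "d \<noteq> 0" and m: "m < n"
  shows "\<exists>e q. e \<noteq> 0 \<and> d dvd e \<and> lead_coeff q = 1 \<and> degree q = n \<and>
    (\<forall>k. d dvd coeff q k - coeff p k) \<and>
    (\<forall>i\<in>{1..m}. \<forall>a b. lead_coeff a = 1 \<and> degree a = i \<and> lead_coeff b = 1 \<and> degree b = n - i \<longrightarrow>
      \<not> (\<forall>k. e dvd coeff (a * b) k - coeff q k))"
  using m
proof (induction m)
  case 0
  show ?case by (rule exI[of _ d], rule exI[of _ p]) (use p d in auto)
next
  case (Suc m)
  then obtain e q where e: "e \<noteq> 0" "d dvd e" and q: "lead_coeff q = 1" "degree q = n"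
    and qp: "\<And>k. d dvd coeff q k - coeff p k"
    and nofac: "\<And>i a b. \<lbrakk>i \<in> {1..m}; lead_coeff a = 1; degree a = i; lead_coeff b = 1;
        degree b = n - i\<rbrakk> \<Longrightarrow> \<not> (\<forall>k. e dvd coeff (a * b) k - coeff q k)"
    by (metis Suc_lessD)
  obtain P s t z where P: "is_ideal P" "finite_index P" "1 \<notin> P"
    and s: "s \<in> P" "s + t * e = 1" and z: "z \<in> P" "z \<noteq> 0"
    using ideals[OF e] by blast
  obtain h where h: "lead_coeff h = 1" "degree h = n"
    and nofac': "\<And>a b. \<lbrakk>lead_coeff a = 1; degree a = Suc m; lead_coeff b = 1;
        degree b = n - Suc m\<rbrakk> \<Longrightarrow> \<not> (\<forall>k. coeff (a * b) k - coeff h k \<in> P)"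
    using ex_monic_without_factor_of_degree[OF P, of "Suc m" n] Suc.prems by auto
  \<comment> \<open>Chinese remainder: \<open>s\<close> is 0 modulo \<open>P\<close> and 1 modulo
    \<open>e\<close>, and \<open>t * e\<close> is the reverse. So \<open>q'\<close> agrees with
    \<open>q\<close> modulo \<open>e\<close> and with \<open>h\<close> modulo \<open>P\<close>, and
    \<open>s + t * e = 1\<close> keeps it monic.\<close>
  define q' where "q' = smult s q + smult (t * e) h"
  have te: "t * e = 1 - s" using s by (simp add: algebra_simps)
  have coeff_q': "coeff q' k = s * coeff q k + t * e * coeff h k" for k
    by (simp add: q'_def)
  have q'q: "coeff q' k - coeff q k = e * (t * (coeff h k - coeff q k))" for k
  proof -
    have "coeff q' k - coeff q k = t * e * coeff h k - (1 - s) * coeff q k"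
      by (simp add: coeff_q' algebra_simps)
    then show ?thesis unfolding te[symmetric] by (simp add: algebra_simps)
  qed
  have q'h: "coeff q' k - coeff h k \<in> P" for k
  proof -
    have "coeff q' k - coeff h k = (coeff q k - coeff h k) * s"
      unfolding coeff_q' te by (simp add: algebra_simps)
    then show ?thesis using is_ideal_mult[OF P(1) s(1)] by simp
  qed
  have q'n: "coeff q' n = 1" using q h s by (simp add: coeff_q')
  have "degree q' = n"
  proof (intro antisym degree_le le_degree allI impI)
    fix k assume "n < k"
    then show "coeff q' k = 0" using q h by (simp add: coeff_q' coeff_eq_0)
  qed (simp add: q'n)
  moreover from this have "lead_coeff q' = 1" using q'n by simp
  moreover have "e * z \<noteq> 0" "d dvd e * z" using e z by auto
  moreover have "d dvd coeff q' k - coeff p k" for k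
  proof -
    have "d dvd (coeff q' k - coeff q k) + (coeff q k - coeff p k)"
      by (intro dvd_add qp) (simp add: q'q e(2) dvd_mult2)
    then show ?thesis by simp
  qed
  moreover have "\<not> (\<forall>k. e * z dvd coeff (a * b) k - coeff q' k)"
    if i: "i \<in> {1..Suc m}" and ab: "lead_coeff a = 1" "degree a = i" "lead_coeff b = 1"
      "degree b = n - i" for i a b
  proof
    assume dvd: "\<forall>k. e * z dvd coeff (a * b) k - coeff q' k"
    show False
    \<comment> \<open>Divisibility by \<open>e * z\<close> gives congruence modulo \<open>P\<close>,
      as \<open>z \<in> P\<close>, and modulo \<open>e\<close>. The new degree contradicts the
      choice of \<open>h\<close>, a smaller one the induction hypothesis.\<close>
    proof (cases "i = Suc m")
      case True
      have "coeff (a * b) k - coeff h k \<in> P" for k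
      proof -
        obtain c where "coeff (a * b) k - coeff q' k = e * z * c" using dvd by (meson dvdE)
        then have "coeff (a * b) k - coeff q' k = (e * c) * z" by (simp add: mult_ac)
        then have "coeff (a * b) k - coeff q' k \<in> P" using is_ideal_mult[OF P(1) z(1)] by simp
        from is_ideal_add[OF P(1) this q'h[of k]] show ?thesis by simp
      qed
      then show False using nofac'[OF ab(1) _ ab(3)] ab True by simp
    next
      case False
      have "e dvd coeff (a * b) k - coeff q k" for k
      proof -
        have "e dvd (coeff (a * b) k - coeff q' k) + (coeff q' k - coeff q k)"
          using dvd by (intro dvd_add) (auto simp: q'q intro: dvd_mult_left)
        then show ?thesis by simp
      qed
      with nofac[OF _ ab] i False show False by auto
    qed
  qed
  ultimately show ?case by blast
qed

lemma is_ideal_add_principal: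
  assumes "is_ideal P"
  shows "is_ideal {s + t * d | s t. s \<in> P}"
proof -
  have "0 \<in> {s + t * d | s t. s \<in> P}"
    using assms unfolding is_ideal_def by (auto intro!: exI[of _ 0])
  moreover have "(s + t * d) + (s' + t' * d) \<in> {s + t * d | s t. s \<in> P}"
    if "s \<in> P" "s' \<in> P" for s s' t t'
    using is_ideal_add[OF assms that]
    by (intro CollectI exI[of _ "s + s'"] exI[of _ "t + t'"]) (simp add: algebra_simps)
  moreover have "r * (s + t * d) \<in> {s + t * d | s t. s \<in> P}" if "s \<in> P" for r s t
    using is_ideal_mult[OF assms that, of r]
    by (intro CollectI exI[of _ "r * s"] exI[of _ "r * t"]) (simp add: algebra_simps)
  ultimately show ?thesis unfolding is_ideal_def by blast
qed

text \<open>The ideal generated by \<open>P\<close> and \<open>e\<close> properly contains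
  \<open>P\<close>, hence contains 1.\<close>

lemma maximal_ideal_coprime:
  assumes P: "is_maximal_ideal P" and e: "e \<notin> P"
  shows "\<exists>s\<in>P. \<exists>t. s + t * e = 1"
proof -
  let ?J = "{s + t * e | s t. s \<in> P}"
  have id: "is_ideal P" using P by (simp add: is_maximal_ideal_def)
  have "P \<subseteq> ?J" by (force intro: exI[of _ 0])
  moreover have "e = 0 + 1 * e" "0 \<in> P"
    using id by (simp_all add: is_ideal_def)
  then have "e \<in> ?J" by blast
  ultimately have "?J = UNIV"
    using P e is_ideal_add_principal[OF id, of e] unfolding is_maximal_ideal_def by blast
  then have "1 \<in> ?J" by blast
  then show ?thesis by force
qed

lemma ex_irreducible_cong:
  fixes d :: "'a::idom"
  assumes inter: "\<Inter> {I :: 'a set. is_maximal_ideal I \<and> finite_index I} = {0}"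
    and d: "d \<noteq> 0" "\<not> d dvd 1"
    and n: "n \<ge> 1" and p: "lead_coeff p = 1" "degree p = n"
  shows "\<exists>q. lead_coeff q = 1 \<and> degree q = n \<and> irreducible q \<and> (\<forall>k. d dvd coeff q k - coeff p k)"
proof -
  have "\<exists>P. is_ideal P \<and> finite_index P \<and> 1 \<notin> P \<and> (\<exists>s\<in>P. \<exists>t. s + t * e = 1) \<and> (\<exists>z\<in>P. z \<noteq> 0)"
    if e: "e \<noteq> 0" "d dvd e" for e
  proof -
    have "e \<notin> \<Inter> {I :: 'a set. is_maximal_ideal I \<and> finite_index I}"
      using inter e(1) by simp
    then obtain P where P: "is_maximal_ideal P" "finite_index P" "e \<notin> P" by blast
    have id: "is_ideal P" using P(1) by (simp add: is_maximal_ideal_def)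
    obtain s t where st: "s \<in> P" "s + t * e = 1" using maximal_ideal_coprime[OF P(1,3)] by blast
    have "1 \<notin> P"
      using is_ideal_mult[OF id, of 1 e] P(3) by auto
    \<comment> \<open>If \<open>s\<close> were 0, then \<open>e\<close>, and with it its divisor
      \<open>d\<close>, would be a unit. So \<open>s\<close> is the nonzero element of
      \<open>P\<close> that is asked for.\<close>
    moreover have "s \<noteq> 0"
      using st(2) e(2) d(2) by (metis add_0 dvd_mult)
    ultimately show ?thesis using id P(2) st by blast
  qed
  note ideals = this
  \<comment> \<open>The degrees from 1 to \<open>n - 1\<close> are all those to be excluded; for
    \<open>n = 1\<close> there are none.\<close>
  have "n - 1 < n" using n by simp
  from ex_monic_without_factors_upto[OF ideals p d(1) this]
  obtain e q where q: "lead_coeff q = 1" "degree q = n" "\<forall>k. d dvd coeff q k - coeff p k"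
    and nofac: "\<And>i a b. \<lbrakk>i \<in> {1..n - 1}; lead_coeff a = 1; degree a = i; lead_coeff b = 1;
        degree b = n - i\<rbrakk> \<Longrightarrow> \<not> (\<forall>k. e dvd coeff (a * b) k - coeff q k)"
    by blast
  have "irreducible q"
  proof (rule irreducible_monicI[OF n q(1,2)])
    fix i and a b :: "'a poly"
    assume "1 \<le> i" "i < n" "lead_coeff a = 1" "degree a = i" "lead_coeff b = 1" "degree b = n - i"
    then have "\<not> (\<forall>k. e dvd coeff (a * b) k - coeff q k)" by (intro nofac) auto
    then show "q \<noteq> a * b" by auto
  qed
  with q show ?thesis by blast
qed

theorem mainTheorem2:
  fixes n :: nat
  assumes "n \<ge> 1"
  shows "IntK n (carrier_mat n n :: ('a::idom) mat set) = IntK n (companions n)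
    \<and> (\<Inter> {I :: 'a set. is_maximal_ideal I \<and> finite_index I} = {0}
         \<longrightarrow> IntK n (carrier_mat n n :: 'a mat set) = IntK n (irred_companions n))"
proof (intro conjI impI)
  show "IntK n (carrier_mat n n :: 'a mat set) = IntK n (companions n)"
  proof (rule IntK_subset_of_in_ideal2[OF assms])
    show "companions n \<subseteq> (carrier_mat n n :: 'a mat set)" by (auto simp: companions_def)
    fix d :: 'a and g p :: "'a poly"
    assume p: "lead_coeff p = 1" "degree p = n"
      and dvd: "\<forall>C\<in>companions n. \<forall>i<n. \<forall>j<n. d dvd poly_mat_eval g C $$ (i, j)"
    have "companion_mat n p \<in> companions n" using p by (auto simp: companions_def)
    with dvd assms show "in_ideal2 d p g"
      by (intro in_ideal2_of_companion[OF assms p]) auto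
  qed
next
  assume inter: "\<Inter> {I :: 'a set. is_maximal_ideal I \<and> finite_index I} = {0}"
  show "IntK n (carrier_mat n n :: 'a mat set) = IntK n (irred_companions n)"
  proof (rule IntK_subset_of_in_ideal2[OF assms])
    show "irred_companions n \<subseteq> (carrier_mat n n :: 'a mat set)"
      by (auto simp: irred_companions_def)
    fix d :: 'a and g p :: "'a poly"
    assume d: "d \<noteq> 0" and p: "lead_coeff p = 1" "degree p = n"
      and dvd: "\<forall>C\<in>irred_companions n. \<forall>i<n. \<forall>j<n. d dvd poly_mat_eval g C $$ (i, j)"
    show "in_ideal2 d p g"
    proof (cases "d dvd 1")
      \<comment> \<open>A unit \<open>d\<close> already generates the whole ring. This covers finite
        fields, where \<open>(0)\<close> is itself maximal of finite index and offers no nonzero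
        element.\<close>
      case True
      then have "\<exists>w. g = smult d w" by (intro smult_of_dvd_coeffs) (rule dvd_trans, auto)
      then show ?thesis unfolding in_ideal2_def by (metis add_0 mult_zero_left)
    next
      case False
      obtain q where q: "lead_coeff q = 1" "degree q = n" "irreducible q"
        and qp: "\<And>k. d dvd coeff q k - coeff p k"
        using ex_irreducible_cong[OF inter d False assms p] by blast
      have "companion_mat n q \<in> irred_companions n" using q by (auto simp: irred_companions_def)
      with dvd assms have "in_ideal2 d q g"
        by (intro in_ideal2_of_companion[OF assms q(1,2)]) auto
      then show ?thesis using qp by (rule in_ideal2_cong)
    qed
  qed
qed

end
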